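(* Let $G_1, G_2$ be two bipartite graphs on $k$ vertices with the same number of connected components, and let $m,n\geq 1$. Then $X_{G_1}^{K_{m,n}} = X_{G_2}^{K_{m,n}}$ (i.e. $G_1$ is $K_{m,n}$-chromatically equivalent to $G_2$) if and only if $\operatorname{diff}(G_1)$ is a permutation of $\operatorname{diff}(G_2)$.
   Context: All graphs are finite, simple, undirected, with at least one vertex. $K_{m,n}$ is the complete bipartite graph with parts of sizes $m$ and $n$. $H$-chromatic symmetric function: let $G,H$ be graphs with $|V(G)|=k$, $|V(H)|=n$. A labeling of $H$ is a bijection $\phi:V(H)\to[n]$. A proper $(H,\phi)$-coloring of $G$ is a map $\kappa:V(G)\to[n]$ such that whenever $u,v$ are adjacent in $G$, $\phi^{-1}(\kappa(u))$ and $\phi^{-1}(\kappa(v))$ are adjacent in $H$. Put $w_G^H=\sum_\phi\sum_\kappa\prod_{v\in V(G)}x_{\kappa(v)}$, summed over all labelings $\phi$ and all proper $(H,\phi)$-colorings $\kappa$. This is a symmetric polynomial in $x_1,\dots,x_n$, homogeneous of degree $k$; writing $w_G^H=\sum_{\lambda\vdash k,\,l(\lambda)\le n}c_\lambda m_\lambda(x_1,\dots,x_n)$ (with $m_\lambda$ the monomial symmetric functions and $l(\lambda)$ the number of parts), define $X_G^H=\sum_{\lambda\vdash k,\,l(\lambda)\le n}c_\lambda m_\lambda\in\Lambda^k$. For a bipartite graph $G$ with connected components $G_1,\dots,G_l$ (listed in some order), let $V_1^i,V_2^i$ be the two parts of the (unique) bipartition of $G_i$ (one part being empty if $G_i$ is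 a single vertex), and $g_j^i=|V_j^i|$. Then $\operatorname{diff}(G)=(|g_1^1-g_2^1|,|g_1^2-g_2^2|,\dots,|g_1^l-g_2^l|)$. *)

theory Defs
  imports
    "Graph_Theory.Kuratowski"
    "HOL-Library.Poly_Mapping"
    "HOL-Library.FuncSet"
    "HOL-Library.Multiset"
    "HOL-Combinatorics.Permutations"
    "HOL-Combinatorics.List_Permutation"
begin

text \<open>
  Finite simple undirected graphs are the symmetric digraphs of locale \<open>graph\<close>, and
  \<open>u \<rightarrow>\<^bsub>G\<^esub> v\<close> is adjacency.  The arguments \<open>m\<close>, \<open>n\<close> of \<open>K\<^bsub>m,n\<^esub>\<close> are the sizes of the two parts.
\<close>

subsection \<open>Bipartite graphs and the sequence diff\<close>

definition bipartition :: "('a, 'b) pre_digraph \<Rightarrow> 'a set \<Rightarrow> 'a set \<Rightarrow> bool" where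
  "bipartition G A B \<longleftrightarrow> A \<union> B = verts G \<and> A \<inter> B = {} \<and>
     (\<forall>u v. u \<rightarrow>\<^bsub>G\<^esub> v \<longrightarrow> (u \<in> A \<and> v \<in> B) \<or> (u \<in> B \<and> v \<in> A))"

definition bipartite :: "('a, 'b) pre_digraph \<Rightarrow> bool" where
  "bipartite G \<longleftrightarrow> (\<exists>A B. bipartition G A B)"

definition components :: "('a, 'b) pre_digraph \<Rightarrow> ('a, 'b) pre_digraph set" where
  "components G = {C. pre_digraph.max_subgraph G Digraph_Component.connected C}"

text \<open>
  The sequence diff depends on the order in which the components are listed: \<open>is_diff G d\<close> says
  that \<open>d\<close> is this sequence for some such order.
\<close>

definition is_diff :: "('a, 'b) pre_digraph \<Rightarrow> int list \<Rightarrow> bool" where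
  "is_diff G d \<longleftrightarrow> (\<exists>Cs. distinct Cs \<and> set Cs = components G \<and>
     list_all2 (\<lambda>C x. \<exists>A B. bipartition C A B \<and> x = \<bar>int (card A) - int (card B)\<bar>) Cs d)"

lemma bipartition_subgraph:
  assumes "subgraph C G" "bipartition G A B"
  shows "bipartition C (A \<inter> verts C) (B \<inter> verts C)"
  unfolding bipartition_def
proof (intro conjI allI impI)
  show "A \<inter> verts C \<union> B \<inter> verts C = verts C" 
    using assms by (auto simp: subgraph_def bipartition_def)
  show "A \<inter> verts C \<inter> (B \<inter> verts C) = {}" using assms by (auto simp: bipartition_def)
  fix u v assume uv: "u \<rightarrow>\<^bsub>C\<^esub> v"
  have "u \<rightarrow>\<^bsub>G\<^esub> v" "u \<in> verts C" "v \<in> verts C"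
    using uv assms(1) by (auto simp: subgraph_def arcs_ends_conv compatible_def wf_digraph_def)
  thus "u \<in> A \<inter> verts C \<and> v \<in> B \<inter> verts C \<or> u \<in> B \<inter> verts C \<and> v \<in> A \<inter> verts C"
    using assms(2) by (auto simp: bipartition_def)
qed

lemma is_diff_exists:
  assumes "graph G" and "bipartite G"
  shows "\<exists>d. is_diff G d"
proof -
  interpret G: graph G by fact
  obtain A B where AB: "bipartition G A B" using assms by (auto simp: bipartite_def)
  have sub: "subgraph C G" if "C \<in> components G" for C
    using that by (auto simp: components_def G.max_subgraph_def)
  have "components G \<subseteq> (\<lambda>(V,E). \<lparr>verts = V, arcs = E, tail = tail G, head = head G\<rparr>) ` (Pow (verts G) \<times> Pow (arcs G))"
  proof
    fix C assume "C \<in> components G"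
    from sub[OF this] have "C = (\<lambda>(V,E). \<lparr>verts = V, arcs = E, tail = tail G, head = head G\<rparr>) (verts C, arcs C)"
      "(verts C, arcs C) \<in> Pow (verts G) \<times> Pow (arcs G)"
      by (auto simp: subgraph_def compatible_def)
    thus "C \<in> (\<lambda>(V,E). \<lparr>verts = V, arcs = E, tail = tail G, head = head G\<rparr>) ` (Pow (verts G) \<times> Pow (arcs G))" by blast
  qed
  hence "finite (components G)" by (rule finite_subset) simp
  then obtain Cs where Cs: "distinct Cs" "set Cs = components G" by (metis finite_distinct_list)
  have "is_diff G (map (\<lambda>C. \<bar>int (card (A \<inter> verts C)) - int (card (B \<inter> verts C))\<bar>) Cs)"
    unfolding is_diff_def using Cs bipartition_subgraph[OF sub AB]
    by (intro exI[of _ Cs]) (auto simp: list_all2_map2 list.rel_refl_strong intro!: list.rel_refl_strong)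
  thus ?thesis by blast
qed


subsection \<open>Monomial symmetric polynomials and functions\<close>

text \<open>
  A monomial in the variables \<open>x\<^sub>1, x\<^sub>2, \<dots>\<close> is given by its exponents, of type \<^typ>\<open>nat \<Rightarrow>\<^sub>0 nat\<close>.
  Polynomials are elements of the ring \<^typ>\<open>(nat \<Rightarrow>\<^sub>0 nat) \<Rightarrow>\<^sub>0 int\<close>.  Symmetric functions are formal
  power series in infinitely many variables, represented by their coefficient functions, of type
  \<^typ>\<open>(nat \<Rightarrow>\<^sub>0 nat) \<Rightarrow> int\<close>.  There is no variable \<open>x\<^sub>0\<close>.
\<close>

definition var :: "nat \<Rightarrow> (nat \<Rightarrow>\<^sub>0 nat) \<Rightarrow>\<^sub>0 int" where
  "var i = Poly_Mapping.single (Poly_Mapping.single i 1) 1"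

text \<open>A partition is the multiset of its (positive) parts.\<close>

definition partitions :: "nat \<Rightarrow> nat \<Rightarrow> nat multiset set" where
  "partitions k n = {l. 0 \<notin># l \<and> sum_mset l = k \<and> size l \<le> n}"

definition exponents :: "(nat \<Rightarrow>\<^sub>0 nat) \<Rightarrow> nat multiset" where
  "exponents a = image_mset (Poly_Mapping.lookup a) (mset_set (Poly_Mapping.keys a))"

definition monomial_sym_poly :: "nat \<Rightarrow> nat multiset \<Rightarrow> (nat \<Rightarrow>\<^sub>0 nat) \<Rightarrow>\<^sub>0 int" where
  "monomial_sym_poly n l =
     (\<Sum>a | Poly_Mapping.keys a \<subseteq> {1..n} \<and> exponents a = l. Poly_Mapping.single a 1)"

definition monomial_sym_fun :: "nat multiset \<Rightarrow> (nat \<Rightarrow>\<^sub>0 nat) \<Rightarrow> int" where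
  "monomial_sym_fun l a = (if 0 \<notin> Poly_Mapping.keys a \<and> exponents a = l then 1 else 0)"


subsection \<open>The H-chromatic symmetric function\<close>

definition labelings :: "('c, 'd) pre_digraph \<Rightarrow> ('c \<Rightarrow> nat) set" where
  "labelings H = {\<phi> \<in> verts H \<rightarrow>\<^sub>E {1..card (verts H)}. bij_betw \<phi> (verts H) {1..card (verts H)}}"

definition proper_colorings ::
  "('a, 'b) pre_digraph \<Rightarrow> ('c, 'd) pre_digraph \<Rightarrow> ('c \<Rightarrow> nat) \<Rightarrow> ('a \<Rightarrow> nat) set" where
  "proper_colorings G H \<phi> = {\<kappa> \<in> verts G \<rightarrow>\<^sub>E {1..card (verts H)}.
     \<forall>u v. u \<rightarrow>\<^bsub>G\<^esub> v \<longrightarrow> inv_into (verts H) \<phi> (\<kappa> u) \<rightarrow>\<^bsub>H\<^esub> inv_into (verts H) \<phi> (\<kappa> v)}"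

definition chromatic_sym_poly ::
  "('a, 'b) pre_digraph \<Rightarrow> ('c, 'd) pre_digraph \<Rightarrow> (nat \<Rightarrow>\<^sub>0 nat) \<Rightarrow>\<^sub>0 int" where
  "chromatic_sym_poly G H =
     (\<Sum>\<phi> \<in> labelings H. \<Sum>\<kappa> \<in> proper_colorings G H \<phi>. \<Prod>v \<in> verts G. var (\<kappa> v))"

definition is_monomial_expansion ::
  "nat \<Rightarrow> nat \<Rightarrow> ((nat \<Rightarrow>\<^sub>0 nat) \<Rightarrow>\<^sub>0 int) \<Rightarrow> (nat multiset \<Rightarrow> int) \<Rightarrow> bool" where
  "is_monomial_expansion k n p c \<longleftrightarrow> (\<forall>l. l \<notin> partitions k n \<longrightarrow> c l = 0) \<and>
     p = (\<Sum>l \<in> partitions k n. of_int (c l) * monomial_sym_poly n l)"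

lemma prod_var: 
  assumes "finite A" 
  shows "(\<Prod>v\<in>A. var (\<kappa> v)) = Poly_Mapping.single (\<Sum>v\<in>A. Poly_Mapping.single (\<kappa> v) 1) 1"
  using assms by (induction rule: finite_induct) (auto simp: var_def Poly_Mapping.mult_single)

lemma lookup_content:
  assumes "finite A" 
  shows "Poly_Mapping.lookup (\<Sum>v\<in>A. Poly_Mapping.single (\<kappa> v) (1::nat)) i = card {v\<in>A. \<kappa> v = i}"
  using assms by (simp add: Poly_Mapping.lookup_sum lookup_single when_def sum.If_cases Int_def)

lemma finite_keys_deg: "finite {a :: nat \<Rightarrow>\<^sub>0 nat. Poly_Mapping.keys a \<subseteq> {1..n} \<and> exponents a = l}" (is "finite ?S")
proof -
  have "Poly_Mapping.lookup ` ?S \<subseteq> {f. \<forall>x. (x \<in> {1..n} \<longrightarrow> f x \<in> insert 0 (set_mset l)) \<and> (x \<notin> {1..n} \<longrightarrow> f x = 0)}"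
    by (auto simp: exponents_def subset_iff) (metis image_eqI in_keys_iff, (metis in_keys_iff)+)
  moreover have "finite {f. \<forall>x. (x \<in> {1..n} \<longrightarrow> f x \<in> insert 0 (set_mset l)) \<and> (x \<notin> {1..n} \<longrightarrow> f x = (0::nat))}"
    by (rule finite_set_of_finite_funs) auto
  ultimately have "finite (Poly_Mapping.lookup ` ?S)" by (rule finite_subset)
  thus ?thesis by (rule finite_imageD) (simp add: inj_on_def lookup_inject)
qed

lemma lookup_monomial_sym_poly:
  "Poly_Mapping.lookup (monomial_sym_poly n l) a = (if Poly_Mapping.keys a \<subseteq> {1..n} \<and> exponents a = l then 1 else 0)"
  unfolding monomial_sym_poly_def Poly_Mapping.lookup_sum lookup_single when_def
  using finite_keys_deg[of n l] by (subst sum.delta) auto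

lemma finite_partitions: "finite (partitions k n)"
proof -
  have "partitions k n \<subseteq> mset ` {xs. set xs \<subseteq> {..k} \<and> length xs \<le> n}"
  proof
    fix l assume l: "l \<in> partitions k n"
    obtain xs where xs: "mset xs = l" using ex_mset by blast
    with l have "set xs \<subseteq> {..k} \<and> length xs \<le> n"
      by (auto simp: partitions_def dest!: sum_mset.remove simp flip: set_mset_mset)
    thus "l \<in> mset ` {xs. set xs \<subseteq> {..k} \<and> length xs \<le> n}" using xs by blast
  qed
  thus ?thesis by (rule finite_subset) (intro finite_imageI finite_lists_length_le, simp)
qed

lemma lookup_of_int_mult: "Poly_Mapping.lookup (of_int c * p) a = c * Poly_Mapping.lookup (p :: (nat \<Rightarrow>\<^sub>0 nat) \<Rightarrow>\<^sub>0 int) a"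
proof -
  have "of_int c * p = Poly_Mapping.single 0 c * p" by (simp flip: single_of_int)
  also have "\<dots> = Poly_Mapping.map ((*) c) p" by (rule mult_map_scale_conv_mult[symmetric])
  finally show ?thesis by (simp add: Poly_Mapping.map.rep_eq when_def)
qed

lemma exponents_partition:
  assumes "Poly_Mapping.keys a \<subseteq> {1..n}" "(\<Sum>i\<in>{1..n}. Poly_Mapping.lookup a i) = k"
  shows "exponents a \<in> partitions k n"
proof -
  have "(\<Sum>i\<in>Poly_Mapping.keys a. Poly_Mapping.lookup a i) = (\<Sum>i\<in>{1..n}. Poly_Mapping.lookup a i)"
    using assms by (intro sum.mono_neutral_left) (auto simp: in_keys_iff)
  thus ?thesis using assms card_mono[of "{1..n}" "Poly_Mapping.keys a"]
    by (auto simp: partitions_def exponents_def in_keys_iff simp flip: sum_unfold_sum_mset)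
qed

lemma exists_exponents:
  assumes "l \<in> partitions k n"
  shows "\<exists>a. Poly_Mapping.keys a \<subseteq> {1..n} \<and> exponents a = l"
proof -
  obtain xs where xs: "mset xs = l" using ex_mset by blast
  have n0: "0 \<notin> set xs" "length xs \<le> n" using assms xs by (auto simp: partitions_def)
  define f where "f i = (if i \<in> {1..length xs} then xs ! (i - 1) else 0)" for i
  have fin: "finite {i. f i \<noteq> 0}" by (rule finite_subset[of _ "{1..length xs}"]) (auto simp: f_def)
  define a where "a = Abs_poly_mapping f"
  have lk: "Poly_Mapping.lookup a = f" unfolding a_def using fin by (simp add: lookup_Abs_poly_mapping)
  have nz: "f i \<noteq> 0" if "i \<in> {1..length xs}" for i 
  proof -
    have "xs ! (i-1) \<in> set xs" using that by (intro nth_mem) auto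
    thus ?thesis using n0 that by (metis f_def)
  qed
  have k: "Poly_Mapping.keys a = {1..length xs}"
    using nz by (auto simp: in_keys_iff lk) (auto simp: f_def split: if_splits)
  have "exponents a = image_mset f (mset_set {1..length xs})" by (simp add: exponents_def lk k)
  also have "\<dots> = image_mset f (image_mset Suc (mset_set {0..<length xs}))"
    by (simp add: image_mset_mset_set image_Suc_atLeastLessThan atLeastLessThanSuc_atLeastAtMost)
  also have "\<dots> = image_mset (\<lambda>i. xs ! i) (mset_set {0..<length xs})"
    by (auto simp: multiset.map_comp f_def intro!: image_mset_cong)
  also have "\<dots> = mset (map (\<lambda>i. xs ! i) [0..<length xs])" by (simp only: mset_map mset_upt)
  also have "\<dots> = l" by (simp add: map_nth xs)
  finally have "exponents a = l" .
  moreover have "Poly_Mapping.keys a \<subseteq> {1..n}" using k n0 by auto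
  ultimately show ?thesis by blast
qed

lemma exponents_eq_permutes:
  assumes "Poly_Mapping.keys a \<subseteq> {1..n}" "Poly_Mapping.keys b \<subseteq> {1..n}" "exponents a = exponents b"
  obtains p where "p permutes {1..n}" "\<And>i. Poly_Mapping.lookup a i = Poly_Mapping.lookup b (p i)"
proof -
  have *: "image_mset (Poly_Mapping.lookup c) (mset_set {1..n}) = exponents c + replicate_mset (n - size (exponents c)) 0"
    if "Poly_Mapping.keys c \<subseteq> {1..n}" for c :: "nat \<Rightarrow>\<^sub>0 nat"
  proof -
    have fk: "finite (Poly_Mapping.keys c)" by simp
    have "mset_set {1..n} = mset_set (Poly_Mapping.keys c) + mset_set ({1..n} - Poly_Mapping.keys c)"
      using that mset_set_Union[of "Poly_Mapping.keys c" "{1..n} - Poly_Mapping.keys c"]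
      by (simp add: Un_absorb1 Un_Diff_cancel)
    moreover have "image_mset (Poly_Mapping.lookup c) (mset_set ({1..n} - Poly_Mapping.keys c)) =
       image_mset (\<lambda>_. 0) (mset_set ({1..n} - Poly_Mapping.keys c))"
      by (intro image_mset_cong) (auto simp: in_keys_iff)
    ultimately show ?thesis using that
      by (simp add: exponents_def image_mset_const_eq card_Diff_subset)
  qed
  have "image_mset (Poly_Mapping.lookup a) (mset_set {1..n}) = image_mset (Poly_Mapping.lookup b) (mset_set {1..n})"
    by (simp only: *[OF assms(1)] *[OF assms(2)] assms(3))
  then obtain p where p: "p permutes {1..n}" "\<forall>x\<in>{1..n}. Poly_Mapping.lookup a x = Poly_Mapping.lookup b (p x)"
    using image_mset_eq_implies_permutes[OF finite_atLeastAtMost] by metis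
  show thesis
  proof (rule that[OF p(1)])
    fix i show "Poly_Mapping.lookup a i = Poly_Mapping.lookup b (p i)"
    proof (cases "i \<in> {1..n}")
      case False
      hence "p i = i" using p(1) by (simp add: permutes_def)
      moreover have "Poly_Mapping.lookup a i = 0" "Poly_Mapping.lookup b i = 0"
        using False assms by (auto simp: in_keys_iff subset_iff)
      ultimately show ?thesis by simp
    qed (use p in auto)
  qed
qed

definition colorings_of where
  "colorings_of G H a = {(\<phi>, \<kappa>). \<phi> \<in> labelings H \<and> \<kappa> \<in> proper_colorings G H \<phi> \<and>
     (\<forall>i. card {v \<in> verts G. \<kappa> v = i} = Poly_Mapping.lookup a i)}"

lemma finite_colorings: assumes "finite (verts G)" "finite (verts H)"
  shows "finite (labelings H)" "finite (proper_colorings G H \<phi>)" 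
  unfolding labelings_def proper_colorings_def using assms
  by (auto intro!: finite_PiE)

lemma lookup_chromatic:
  assumes "finite (verts G)" "finite (verts H)"
  shows "Poly_Mapping.lookup (chromatic_sym_poly G H) a = int (card (colorings_of G H a))"
proof -
  have eq: "(\<Sum>v\<in>verts G. Poly_Mapping.single (\<kappa> v) 1) = a \<longleftrightarrow> 
     (\<forall>i. card {v \<in> verts G. \<kappa> v = i} = Poly_Mapping.lookup a i)" for \<kappa>
    using assms by (simp add: poly_mapping_eq_iff fun_eq_iff lookup_content del: One_nat_def)
  have "Poly_Mapping.lookup (chromatic_sym_poly G H) a = 
     (\<Sum>\<phi> \<in> labelings H. \<Sum>\<kappa> \<in> proper_colorings G H \<phi>. if (\<forall>i. card {v \<in> verts G. \<kappa> v = i} = Poly_Mapping.lookup a i) then 1 else 0)"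
    using assms by (simp add: chromatic_sym_poly_def Poly_Mapping.lookup_sum prod_var lookup_single when_def eq[symmetric] eq_commute[of a])
  also have "\<dots> = (\<Sum>(\<phi>,\<kappa>) \<in> Sigma (labelings H) (proper_colorings G H). if (\<forall>i. card {v \<in> verts G. \<kappa> v = i} = Poly_Mapping.lookup a i) then 1 else 0)"
    using finite_colorings[OF assms] by (subst sum.Sigma) auto
  also have "\<dots> = int (card (colorings_of G H a))"
    unfolding colorings_of_def using finite_colorings[OF assms]
    by (simp add: case_prod_unfold sum.If_cases finite_SigmaI) (rule arg_cong[of _ _ card], auto)
  finally show ?thesis .
qed

lemma bij_betw_comp_inv:
  assumes "bij_betw f A B" "x \<in> B" "p permutes B"
  shows "inv_into A (restrict (p \<circ> f) A) (p x) = inv_into A f x"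
proof -
  have i: "inv_into A f x \<in> A" "f (inv_into A f x) = x" using assms
    by (auto simp: bij_betw_def intro: inv_into_into f_inv_into_f)
  have "inj_on (restrict (p \<circ> f) A) A"
    using assms by (auto simp: inj_on_def bij_betw_def dest: permutes_inj)
  from inv_into_f_f[OF this i(1)] show ?thesis using i by simp
qed

lemma card_colorings_le:
  assumes G: "wf_digraph G" "finite (verts G)" "finite (verts H)"
   and p: "p permutes {1..card (verts H)}" and ab: "\<And>i. Poly_Mapping.lookup a i = Poly_Mapping.lookup b (p i)"
  shows "card (colorings_of G H a) \<le> card (colorings_of G H b)"
proof (rule card_inj_on_le)
  let ?n = "card (verts H)"
  let ?F = "\<lambda>(\<phi>,\<kappa>). (restrict (p \<circ> \<phi>) (verts H), restrict (p \<circ> \<kappa>) (verts G))"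
  show "finite (colorings_of G H b)"
    by (rule finite_subset[of _ "Sigma (labelings H) (proper_colorings G H)"])
       (auto simp: colorings_of_def finite_colorings[OF G(2,3)] intro!: finite_SigmaI)
  have pj: "inj p" using p by (rule permutes_inj)
  show "inj_on ?F (colorings_of G H a)"
  proof (rule inj_onI, clarify)
    fix f k f' k' assume A: "(f,k) \<in> colorings_of G H a" "(f',k') \<in> colorings_of G H a"
      and e: "restrict (p \<circ> f) (verts H) = restrict (p \<circ> f') (verts H)" 
        "restrict (p \<circ> k) (verts G) = restrict (p \<circ> k') (verts G)"
    have "f x = f' x" if "x \<in> verts H" for x
      using fun_cong[OF e(1), of x] that pj by (simp add: inj_eq)
    moreover have "k x = k' x" if "x \<in> verts G" for x
      using fun_cong[OF e(2), of x] that pj by (simp add: inj_eq)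
    moreover have "f \<in> extensional (verts H)" "f' \<in> extensional (verts H)" 
       "k \<in> extensional (verts G)" "k' \<in> extensional (verts G)"
      using A by (auto simp: colorings_of_def labelings_def proper_colorings_def PiE_def)
    ultimately show "f = f' \<and> k = k'" by (meson extensionalityI)
  qed
  show "?F ` colorings_of G H a \<subseteq> colorings_of G H b"
  proof clarify
    fix f k assume A: "(f,k) \<in> colorings_of G H a"
    let ?f = "restrict (p \<circ> f) (verts H)" and ?k = "restrict (p \<circ> k) (verts G)"
    have f: "bij_betw f (verts H) {1..?n}" "\<And>x. x \<in> verts H \<Longrightarrow> f x \<in> {1..?n}"
      and k: "\<And>x. x \<in> verts G \<Longrightarrow> k x \<in> {1..?n}" 
      and kk: "\<And>u v. u \<rightarrow>\<^bsub>G\<^esub> v \<Longrightarrow> inv_into (verts H) f (k u) \<rightarrow>\<^bsub>H\<^esub> inv_into (verts H) f (k v)"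
      and ct: "\<And>i. card {v \<in> verts G. k v = i} = Poly_Mapping.lookup a i"
      using A by (auto simp: colorings_of_def labelings_def proper_colorings_def PiE_def Pi_def)
    have bij: "bij_betw ?f (verts H) {1..?n}"
      using bij_betw_trans[OF f(1) permutes_imp_bij[OF p]] by (subst bij_betw_restrict_eq)
    have pin: "p x \<in> {1..?n}" if "x \<in> {1..?n}" for x using permutes_in_image[OF p] that by blast
    have 1: "?f \<in> labelings H" unfolding labelings_def using bij f(2) pin by auto
    have 2: "?k \<in> proper_colorings G H ?f"
      unfolding proper_colorings_def
    proof (intro CollectI conjI allI impI)
      show "?k \<in> verts G \<rightarrow>\<^sub>E {1..?n}" using k pin by auto
      fix u v assume uv: "u \<rightarrow>\<^bsub>G\<^esub> v"
      have V: "u \<in> verts G" "v \<in> verts G" using uv G(1) 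
        by (auto simp: arcs_ends_conv wf_digraph_def)
      thus "inv_into (verts H) ?f (?k u) \<rightarrow>\<^bsub>H\<^esub> inv_into (verts H) ?f (?k v)"
        using kk[OF uv] bij_betw_comp_inv[OF f(1) k p] by simp
    qed
    have 3: "card {v \<in> verts G. ?k v = i} = Poly_Mapping.lookup b i" for i
    proof -
      obtain j where j: "i = p j" using permutes_surj[OF p] by blast
      have "{v \<in> verts G. ?k v = i} = {v \<in> verts G. k v = j}" using pj by (auto simp: j inj_eq)
      thus ?thesis using ct ab by (simp add: j)
    qed
    show "(?f, ?k) \<in> colorings_of G H b" using 1 2 3 by (simp add: colorings_of_def)
  qed
qed

lemma lookup_chromatic_sym:
  assumes "wf_digraph G" "finite (verts G)" "finite (verts H)"
   and "Poly_Mapping.keys a \<subseteq> {1..card (verts H)}" "Poly_Mapping.keys b \<subseteq> {1..card (verts H)}" "exponents a = exponents b"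
  shows "Poly_Mapping.lookup (chromatic_sym_poly G H) a = Poly_Mapping.lookup (chromatic_sym_poly G H) b"
proof -
  have "card (colorings_of G H a) \<le> card (colorings_of G H b)"
    using exponents_eq_permutes[OF assms(4-6)] card_colorings_le[OF assms(1-3)] by metis
  moreover have "card (colorings_of G H b) \<le> card (colorings_of G H a)"
    using exponents_eq_permutes[OF assms(5,4)] assms(6) card_colorings_le[OF assms(1-3)] by metis
  ultimately show ?thesis using assms by (simp add: lookup_chromatic)
qed

lemma lookup_chromatic_nz:
  assumes "finite (verts G)" "finite (verts H)" "Poly_Mapping.lookup (chromatic_sym_poly G H) a \<noteq> 0"
  shows "Poly_Mapping.keys a \<subseteq> {1..card (verts H)}" "exponents a \<in> partitions (card (verts G)) (card (verts H))"
proof -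
  let ?n = "card (verts H)"
  have "colorings_of G H a \<noteq> {}" using assms by (auto simp: lookup_chromatic)
  then obtain f k where "(f, k) \<in> colorings_of G H a" by auto
  hence k: "\<And>x. x \<in> verts G \<Longrightarrow> k x \<in> {1..?n}" and c: "\<And>i. Poly_Mapping.lookup a i = card {v \<in> verts G. k v = i}"
    by (auto simp: colorings_of_def proper_colorings_def PiE_def Pi_def)
  show K: "Poly_Mapping.keys a \<subseteq> {1..?n}" 
  proof
    fix i assume "i \<in> Poly_Mapping.keys a"
    hence "{v \<in> verts G. k v = i} \<noteq> {}" by (metis c card.empty in_keys_iff)
    thus "i \<in> {1..?n}" using k by blast
  qed
  have "(\<Sum>i\<in>{1..?n}. card {v \<in> verts G. k v = i}) = card (\<Union>i\<in>{1..?n}. {v \<in> verts G. k v = i})"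
    using assms by (subst card_UN_disjoint) auto
  also have "(\<Union>i\<in>{1..?n}. {v \<in> verts G. k v = i}) = verts G" using k by blast
  finally show "exponents a \<in> partitions (card (verts G)) ?n"
    using K by (intro exponents_partition) (simp_all add: c)
qed

lemma lookup_expansion:
  "Poly_Mapping.lookup (\<Sum>l \<in> partitions k n. of_int (c l) * monomial_sym_poly n l) a =
   (if Poly_Mapping.keys a \<subseteq> {1..n} \<and> exponents a \<in> partitions k n then c (exponents a) else 0)"
proof -
  have "Poly_Mapping.lookup (\<Sum>l \<in> partitions k n. of_int (c l) * monomial_sym_poly n l) a =
    (\<Sum>l \<in> partitions k n. if exponents a = l then (if Poly_Mapping.keys a \<subseteq> {1..n} then c l else 0) else 0)"
    unfolding Poly_Mapping.lookup_sum lookup_of_int_mult lookup_monomial_sym_poly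
    by (intro sum.cong) auto
  thus ?thesis using finite_partitions[of k n] by (simp add: sum.delta')
qed

lemma ex1_monomial_expansion:
  assumes "graph G" and "graph H"
  shows "\<exists>!c. is_monomial_expansion (card (verts G)) (card (verts H)) (chromatic_sym_poly G H) c"
proof -
  interpret G: graph G by fact
  interpret H: graph H by fact
  let ?k = "card (verts G)" and ?n = "card (verts H)" and ?w = "chromatic_sym_poly G H"
  define r where "r l = (SOME a. Poly_Mapping.keys a \<subseteq> {1..?n} \<and> exponents a = l)" for l
  have r: "Poly_Mapping.keys (r l) \<subseteq> {1..?n}" "exponents (r l) = l" if "l \<in> partitions ?k ?n" for l
    using someI_ex[OF exists_exponents[OF that]] by (auto simp: r_def)
  define c where "c l = (if l \<in> partitions ?k ?n then Poly_Mapping.lookup ?w (r l) else 0)" for l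
  show ?thesis
  proof (rule ex1I[of _ c])
    have "Poly_Mapping.lookup ?w a = Poly_Mapping.lookup (\<Sum>l \<in> partitions ?k ?n. of_int (c l) * monomial_sym_poly ?n l) a" for a
      unfolding lookup_expansion
    proof (cases "Poly_Mapping.keys a \<subseteq> {1..?n} \<and> exponents a \<in> partitions ?k ?n")
      case True
      have "Poly_Mapping.lookup ?w a = Poly_Mapping.lookup ?w (r (exponents a))"
        using True r by (intro lookup_chromatic_sym G.wf_digraph) auto
      thus "Poly_Mapping.lookup ?w a = (if Poly_Mapping.keys a \<subseteq> {1..?n} \<and> exponents a \<in> partitions ?k ?n then c (exponents a) else 0)"
        using True by (simp add: c_def)
    next
      case False
      thus "Poly_Mapping.lookup ?w a = (if Poly_Mapping.keys a \<subseteq> {1..?n} \<and> exponents a \<in> partitions ?k ?n then c (exponents a) else 0)"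
        using lookup_chromatic_nz[of G H a] by force
    qed
    hence "?w = (\<Sum>l \<in> partitions ?k ?n. of_int (c l) * monomial_sym_poly ?n l)" by (intro poly_mapping_eqI)
    thus "is_monomial_expansion ?k ?n ?w c" by (simp add: is_monomial_expansion_def c_def)
    fix c' assume c': "is_monomial_expansion ?k ?n ?w c'"
    show "c' = c"
    proof
      fix l show "c' l = c l"
      proof (cases "l \<in> partitions ?k ?n")
        case True
        have "Poly_Mapping.lookup ?w (r l) = c' l"
          using c' r[OF True] True lookup_expansion[where a = "r l" and c = c' and k = ?k and n = ?n]
          unfolding is_monomial_expansion_def by simp
        thus ?thesis using True by (simp add: c_def)
      qed (use c' in \<open>auto simp: is_monomial_expansion_def c_def\<close>)
    qed
  qed
qed

definition monomial_coeffs ::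
  "('a, 'b) pre_digraph \<Rightarrow> ('c, 'd) pre_digraph \<Rightarrow> nat multiset \<Rightarrow> int" where
  "monomial_coeffs G H =
     (THE c. is_monomial_expansion (card (verts G)) (card (verts H)) (chromatic_sym_poly G H) c)"

definition chromatic_sym_fun ::
  "('a, 'b) pre_digraph \<Rightarrow> ('c, 'd) pre_digraph \<Rightarrow> (nat \<Rightarrow>\<^sub>0 nat) \<Rightarrow> int" where
  "chromatic_sym_fun G H = (\<lambda>a. \<Sum>l \<in> partitions (card (verts G)) (card (verts H)).
     monomial_coeffs G H l * monomial_sym_fun l a)"

end

theory Submission
  imports Defs "HOL-Computational_Algebra.Polynomial"
begin

text \<open>
  A proper coloring by \<open>K\<^bsub>m,n\<^esub>\<close> amounts to a side \<open>U\<close> of \<open>G\<close> (one part of a bipartition), whose vertices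
  get colors from the first part of \<open>K\<^bsub>m,n\<^esub>\<close>, while the other vertices get colors from the second. So
  the chromatic polynomial depends only on \<open>k\<close> and on the numbers of sides of each size.
  Conversely, it determines these numbers, by its coefficients at \<open>x\<^sub>1\<^sup>j x\<^sub>2\<^sup>k\<^sup>-\<^sup>j\<close>. Choosing
  a side in each component independently gives
  \<open>\<Sum>\<^sub>U x\<^bsup>|U|\<^esup> = x\<^sup>e \<Prod>\<^sub>i (1 + x\<^bsup>d\<^sub>i\<^esup>)\<close> with \<open>d = diff G\<close> and \<open>2 e + \<Sum>\<^sub>i d\<^sub>i = k\<close>,
  and such a product determines the multiset of the \<open>d\<^sub>i\<close>, as one sees by cancelling the factor
  with the least \<open>d\<^sub>i\<close>.
\<close>

section \<open>Sides and components\<close>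

lemma arc_mono_connected: "arc_mono Digraph_Component.connected"
  by (auto simp: arc_mono_def)
     (metis spanning_def subgraphE wf_digraph.connected_spanning_imp_connected)

lemma (in wf_digraph) strongly_connected_imp_connected:
  assumes "strongly_connected G"
  shows "Digraph_Component.connected G"
  using assms
  by (intro connectedI) (auto simp: strongly_connected_def intro: reachable_mk_symmetricI)

lemma (in sym_digraph) induced_connected_imp_strongly_connected:
  assumes "induced_subgraph H G" "Digraph_Component.connected H"
  shows "strongly_connected H"
proof -
  interpret H: wf_digraph H using assms by auto
  show ?thesis
    using assms induced_graph_imp_symmetric[OF sym_arcs]
    by (intro H.symmetric_connected_imp_strongly_connected)
qed

text \<open>Adding arcs on the same vertices keeps a graph connected, so a maximal connected
  subgraph is induced; an induced subgraph of a symmetric digraph is symmetric, and there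
  connectedness and strong connectedness agree. This makes the disjointness, covering and finiteness
  results for \<open>sccs\<close> available for components.\<close>

lemma (in sym_digraph) components_eq_sccs: "components G = sccs"
proof (intro equalityI subsetI)
  fix C assume "C \<in> components G"
  hence C: "max_subgraph Digraph_Component.connected C" by (simp add: components_def)
  have "induced_subgraph C G" by (rule induced_subgraphI_arc_mono[OF C arc_mono_connected])
  hence sc: "strongly_connected C"
    using induced_connected_imp_strongly_connected max_subgraph_prop[OF C] by blast
  have "\<not> strongly_connected H" if "C \<noteq> H" "subgraph C H" "subgraph H G" for H
    using C that wf_digraph.strongly_connected_imp_connected[of H]
    by (auto simp: max_subgraph_def)
  hence "max_subgraph strongly_connected C"
    using sc subgraphI_max_subgraph[OF C] by (intro max_subgraphI) auto
  thus "C \<in> sccs" by (simp add: sccs_altdef2)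
next
  fix C assume "C \<in> sccs"
  hence C: "induced_subgraph C G" "strongly_connected C"
    and max: "\<And>H. induced_subgraph H G \<Longrightarrow> strongly_connected H \<Longrightarrow> \<not> verts C \<subset> verts H"
    by (auto simp: sccs_def)
  have "\<not> Digraph_Component.connected H" if H: "C \<noteq> H" "subgraph C H" "subgraph H G" for H
  proof
    assume "Digraph_Component.connected H"
    \<comment> \<open>\<open>H\<close> need not be induced, so it is replaced by the induced
      subgraph on its vertices, which stays connected and hence is strongly connected.\<close>
    hence "Digraph_Component.connected (G \<restriction> verts H)"
      using arc_mono_connected subgraph_induce_subgraphI2[OF H(3)]
      unfolding arc_mono_def by (metis induce_subgraph_verts)
    moreover have ind: "induced_subgraph (G \<restriction> verts H) G" using H by (auto intro: induced_induce)
    ultimately have "\<not> verts C \<subset> verts H"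
      using max[OF ind] induced_connected_imp_strongly_connected by simp
    \<comment> \<open>An induced subgraph is the largest subgraph on its vertex set, so a different
      \<open>H\<close> above \<open>C\<close> has a new vertex.\<close>
    moreover have "verts C \<subset> verts H"
      using C(1) H by (auto simp: induced_subgraph_altdef2 max_subgraph_def)
    ultimately show False by blast
  qed
  moreover have "Digraph_Component.connected C"
    using C wf_digraph.strongly_connected_imp_connected by blast
  ultimately show "C \<in> components G"
    using C unfolding components_def by (auto intro: max_subgraphI)
qed

section \<open>Sides of a graph\<close>

definition sides :: "('a, 'b) pre_digraph \<Rightarrow> 'a set set" where
  "sides G = {U. bipartition G U (verts G - U)}"

lemma bipartition_sides:
  "bipartition G A B \<longleftrightarrow> A \<in> sides G \<and> B = verts G - A"
  unfolding sides_def bipartition_def by blast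

lemma sides_subset: "U \<in> sides G \<Longrightarrow> U \<subseteq> verts G"
  unfolding sides_def bipartition_def by auto

lemma finite_sides: "finite (verts G) \<Longrightarrow> finite (sides G)"
  by (rule finite_subset[of _ "Pow (verts G)"]) (auto dest: sides_subset)

lemma (in wf_digraph) sides_iff:
  "U \<in> sides G \<longleftrightarrow> U \<subseteq> verts G \<and> (\<forall>e\<in>arcs G. (tail G e \<in> U) \<noteq> (head G e \<in> U))"
  unfolding sides_def bipartition_def arcs_ends_conv by fastforce

text \<open>A bipartition of a connected graph is unique up to swapping its parts. The parts differ
  because a strongly connected graph has a vertex, so a component always contributes two distinct
  sides.\<close>

lemma (in wf_digraph) sides_strongly_connected:
  assumes "strongly_connected G" "bipartition G A B"
  shows "sides G = {A, B}" "A \<noteq> B"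
proof -
  have A: "A \<in> sides G" and B: "B = verts G - A" using assms by (auto simp: bipartition_sides)
  obtain u where u: "u \<in> verts G" using assms by (auto simp: strongly_connected_def)
  \<comment> \<open>Crossing an arc flips membership in \<open>A\<close> and in \<open>U\<close>
    alike, so whether the two agree at a vertex is constant along walks from
    \<open>u\<close>.\<close>
  have *: "(v \<in> A \<longleftrightarrow> v \<in> U) \<longleftrightarrow> (u \<in> A \<longleftrightarrow> u \<in> U)" if U: "U \<in> sides G" and v: "v \<in> verts G" for U v
  proof -
    have "u \<rightarrow>\<^sup>* v" using u v assms by auto
    thus ?thesis
    proof (induction rule: reachable_induct)
      case (step x y)
      then obtain e where "e \<in> arcs G" "tail G e = x" "head G e = y" by (auto simp: arcs_ends_conv)
      thus ?case using step A U by (auto simp: sides_iff)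
    qed simp
  qed
  show "A \<noteq> B" using B u sides_subset[OF A] by auto
  have "U \<in> {A, B}" if U: "U \<in> sides G" for U
    using *[OF U] sides_subset[OF U] sides_subset[OF A] by (cases "u \<in> A \<longleftrightarrow> u \<in> U") (auto simp: B)
  moreover have "B \<in> sides G" using A by (auto simp: sides_iff B)
  ultimately show "sides G = {A, B}" using A by blast
qed


section \<open>Decomposition of sides over the components\<close>

lemma (in sym_digraph) Union_components_verts: "(\<Union>C\<in>components G. verts C) = verts G"
  using graph_is_union_sccs by (auto simp: components_eq_sccs Union_def dest: arg_cong[of _ _ verts])

lemma (in sym_digraph) components_subgraph: "C \<in> components G \<Longrightarrow> subgraph C G"
  by (simp add: components_def subgraphI_max_subgraph)

lemma (in sym_digraph) components_disjoint:
  "C \<in> components G \<Longrightarrow> D \<in> components G \<Longrightarrow> v \<in> verts C \<Longrightarrow> v \<in> verts D \<Longrightarrow> C = D"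
  using scc_disj by (auto simp: components_eq_sccs)

lemma (in sym_digraph) arc_in_component:
  assumes "e \<in> arcs G"
  obtains C where "C \<in> components G" "e \<in> arcs C"
proof -
  have "arcs (Union sccs) = arcs G" by (simp add: graph_is_union_sccs)
  thus thesis using assms that by (auto simp: components_eq_sccs Union_def)
qed

lemma (in pseudo_graph) finite_components: "finite (components G)"
proof -
  have "finite (verts ` sccs)" using finite_sccs_verts by (simp add: sccs_verts_conv)
  thus ?thesis unfolding components_eq_sccs using inj_on_verts_sccs by (rule finite_imageD)
qed

lemma (in pseudo_graph) finite_verts_component: "C \<in> components G \<Longrightarrow> finite (verts C)"
  by (rule finite_subset[OF subgraph_imp_subverts[OF components_subgraph] finite_verts])

lemma sides_subgraph:
  assumes "subgraph C G" "U \<in> sides G"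
  shows "U \<inter> verts C \<in> sides C"
  using bipartition_subgraph[OF assms(1), of U "verts G - U"] assms(2)
  by (simp add: sides_def[of G] bipartition_sides[of C])

text \<open>Every arc stays inside one component, so sides chosen independently can be glued.
  Disjointness of the components lets each choice be recovered from the union.\<close>

lemma (in sym_digraph) Union_sides_components:
  assumes "\<And>C. C \<in> components G \<Longrightarrow> g C \<in> sides C"
  shows "(\<Union>C\<in>components G. g C) \<in> sides G" (is "?U \<in> _")
    and "\<And>C. C \<in> components G \<Longrightarrow> (\<Union>C\<in>components G. g C) \<inter> verts C = g C"
proof -
  have sub: "g C \<subseteq> verts C" if "C \<in> components G" for C using assms[OF that] by (rule sides_subset)
  show int: "?U \<inter> verts C = g C" if "C \<in> components G" for C
  proof
    show "?U \<inter> verts C \<subseteq> g C"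
    proof
      fix v assume "v \<in> ?U \<inter> verts C"
      then obtain D where "D \<in> components G" "v \<in> g D" "v \<in> verts C" by auto
      thus "v \<in> g C" using components_disjoint[of C D v] sub that by auto
    qed
  qed (use sub that in auto)
  show "?U \<in> sides G"
    unfolding sides_iff
  proof (intro conjI ballI)
    show "?U \<subseteq> verts G" using sub Union_components_verts by blast
    fix e assume "e \<in> arcs G"
    then obtain C where C: "C \<in> components G" "e \<in> arcs C" by (rule arc_in_component)
    interpret C: wf_digraph C using components_subgraph[OF C(1)] by auto
    have "tail C e \<in> verts C" "head C e \<in> verts C" using C(2) by auto
    moreover have "(tail C e \<in> g C) \<noteq> (head C e \<in> g C)" using assms[OF C(1)] C(2) by (simp add: C.sides_iff)
    moreover have "tail C = tail G" "head C = head G"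
      using components_subgraph[OF C(1)] by (auto simp: subgraph_def compatible_def)
    ultimately show "(tail G e \<in> ?U) \<noteq> (head G e \<in> ?U)" using int[OF C(1)] by auto
  qed
qed

text \<open>Expanding the product gives a sum over choices of one side per component. Gluing and
  restricting are mutually inverse between these choices and the sides of \<open>G\<close>, and
  cardinality is additive over the disjoint pieces.\<close>

lemma (in pseudo_graph) sum_sides_eq_prod_components:
  fixes x :: "'c :: comm_semiring_1"
  shows "(\<Sum>U\<in>sides G. x ^ card U) = (\<Prod>C\<in>components G. \<Sum>U\<in>sides C. x ^ card U)"
proof -
  note fin = finite_verts_component
  have "(\<Prod>C\<in>components G. \<Sum>U\<in>sides C. x ^ card U) =
      (\<Sum>g\<in>PiE (components G) sides. \<Prod>C\<in>components G. x ^ card (g C))"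
    by (intro prod_sum_PiE finite_components finite_sides fin)
  also have "\<dots> = (\<Sum>U\<in>sides G. x ^ card U)"
  proof (rule sum.reindex_bij_witness[where j = "\<lambda>g. \<Union>C\<in>components G. g C"
        and i = "\<lambda>U. \<lambda>C\<in>components G. U \<inter> verts C"])
    fix g assume g: "g \<in> PiE (components G) sides"
    hence gs: "g C \<in> sides C" if "C \<in> components G" for C using that by auto
    note U = Union_sides_components[of g, OF gs]
    show "(\<Union>C\<in>components G. g C) \<in> sides G" by (rule U(1))
    show "(\<lambda>C\<in>components G. (\<Union>C\<in>components G. g C) \<inter> verts C) = g"
    proof
      fix C show "(\<lambda>C\<in>components G. (\<Union>C\<in>components G. g C) \<inter> verts C) C = g C"
        using U(2)[of C] g by (cases "C \<in> components G") (auto simp: PiE_def extensional_def)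
    qed
    have sub: "g C \<subseteq> verts C" if "C \<in> components G" for C using gs[OF that] by (rule sides_subset)
    have "card (\<Union>C\<in>components G. g C) = (\<Sum>C\<in>components G. card (g C))"
    proof (intro card_UN_disjoint finite_components ballI impI)
      fix C assume "C \<in> components G"
      thus "finite (g C)" using fin sub finite_subset by blast
    next
      fix C D assume "C \<in> components G" "D \<in> components G" "C \<noteq> D"
      thus "g C \<inter> g D = {}" using components_disjoint sub by blast
    qed
    thus "x ^ card (\<Union>C\<in>components G. g C) = (\<Prod>C\<in>components G. x ^ card (g C))"
      by (simp add: power_sum)
  next
    fix U assume U: "U \<in> sides G"
    show "(\<Union>C\<in>components G. (\<lambda>C\<in>components G. U \<inter> verts C) C) = U"
      using sides_subset[OF U] Union_components_verts by auto
    show "(\<lambda>C\<in>components G. U \<inter> verts C) \<in> PiE (components G) sides"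
      using sides_subgraph[OF components_subgraph U] by auto
  qed
  finally show ?thesis by simp
qed

text \<open>A component with parts of sizes a and b contributes x^a + x^b = x^l (1 + x^|a-b|) with l
  = min a b. Since 2 l + |a-b| is its number of vertices, the total power of x in front is
  determined by the order of \<open>G\<close> and the sum of \<open>d\<close>.\<close>

lemma (in pseudo_graph) sum_sides_eq_prod_diff:
  fixes x :: "'c :: comm_semiring_1"
  assumes "is_diff G d"
  shows "(\<Sum>U\<in>sides G. x ^ card U) =
    x ^ ((card (verts G) - sum_list (map nat d)) div 2) * (\<Prod>i\<in>#mset (map nat d). 1 + x ^ i)"
proof -
  obtain Cs where Cs: "distinct Cs" "set Cs = components G"
    and d: "list_all2 (\<lambda>C x. \<exists>A B. bipartition C A B \<and> x = \<bar>int (card A) - int (card B)\<bar>) Cs d"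
    using assms by (auto simp: is_diff_def)
  \<comment> \<open>An inclusion, unlike the equation, passes to the tail of the list in the
    induction.\<close>
  have "set Cs \<subseteq> components G" using Cs by simp
  with d have "\<exists>e. 2 * e + sum_list (map nat d) = (\<Sum>C\<leftarrow>Cs. card (verts C)) \<and>
      (\<Prod>C\<leftarrow>Cs. \<Sum>U\<in>sides C. x ^ card U) = x ^ e * (\<Prod>i\<in>#mset (map nat d). 1 + x ^ i)"
  proof (induction rule: list_all2_induct)
    case Nil
    show ?case by (intro exI[of _ 0]) simp
  next
    case (Cons C Cs y d)
    then obtain e where e: "2 * e + sum_list (map nat d) = (\<Sum>C\<leftarrow>Cs. card (verts C))"
      "(\<Prod>C\<leftarrow>Cs. \<Sum>U\<in>sides C. x ^ card U) = x ^ e * (\<Prod>i\<in>#mset (map nat d). 1 + x ^ i)" by auto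
    obtain A B where AB: "bipartition C A B" and y: "y = \<bar>int (card A) - int (card B)\<bar>" using Cons by auto
    have C: "C \<in> components G" using Cons by simp
    interpret C: wf_digraph C using components_subgraph[OF C] by auto
    have "strongly_connected C" using C by (auto simp: components_eq_sccs)
    note S = C.sides_strongly_connected[OF this AB]
    have V: "verts C = A \<union> B" "A \<inter> B = {}" using AB by (auto simp: bipartition_def)
    hence k: "card (verts C) = card A + card B" using finite_verts_component[OF C] by (simp add: card_Un_disjoint)
    define l where "l = min (card A) (card B)"
    have l: "2 * l + nat y = card (verts C)" unfolding k y l_def by auto
    have "(\<Sum>U\<in>sides C. x ^ card U) = x ^ card A + x ^ card B" using S by simp
    also have "\<dots> = x ^ l + x ^ (l + nat y)"
      by (cases "card A \<le> card B") (simp_all add: l_def y nat_diff_distrib min_def ac_simps)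
    also have "\<dots> = x ^ l * (1 + x ^ nat y)" by (simp add: algebra_simps power_add)
    finally show ?case using e l
      by (intro exI[of _ "l + e"]) (simp add: power_add mult_ac)
  qed
  then obtain e where e: "2 * e + sum_list (map nat d) = (\<Sum>C\<leftarrow>Cs. card (verts C))"
      "(\<Prod>C\<leftarrow>Cs. \<Sum>U\<in>sides C. x ^ card U) = x ^ e * (\<Prod>i\<in>#mset (map nat d). 1 + x ^ i)" by auto
  have "(\<Sum>C\<leftarrow>Cs. card (verts C)) = (\<Sum>C\<in>components G. card (verts C))"
    using sum.distinct_set_conv_list[OF Cs(1)] Cs(2) by metis
  also have "\<dots> = card (\<Union>C\<in>components G. verts C)"
  proof (intro card_UN_disjoint[symmetric] finite_components finite_verts_component ballI impI)
    fix C D assume "C \<in> components G" "D \<in> components G" "C \<noteq> D"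
    thus "verts C \<inter> verts D = {}" using components_disjoint by blast
  qed
  finally have k: "(\<Sum>C\<leftarrow>Cs. card (verts C)) = card (verts G)" by (simp only: Union_components_verts)
  have "(\<Sum>U\<in>sides G. x ^ card U) = (\<Prod>C\<leftarrow>Cs. \<Sum>U\<in>sides C. x ^ card U)"
    using prod.distinct_set_conv_list[OF Cs(1)] Cs(2) sum_sides_eq_prod_components by metis
  \<comment> \<open>The subtraction does not truncate and the division is exact, as the difference
    equals 2 e.\<close>
  moreover have "e = (card (verts G) - sum_list (map nat d)) div 2" using e(1) k by simp
  ultimately show ?thesis using e(2) by simp
qed

section \<open>Products of the polynomials $1 + x^d$\<close>

definition binomial_prod :: "nat multiset \<Rightarrow> int poly" where
  "binomial_prod D = (\<Prod>i\<in>#D. 1 + monom 1 i)"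

lemma binomial_prod_add_mset: "binomial_prod (add_mset i D) = (1 + monom 1 i) * binomial_prod D"
  by (simp add: binomial_prod_def)

lemma coeff_binomial_prod_add_mset:
  "coeff (binomial_prod (add_mset i D)) j =
     coeff (binomial_prod D) j + (if j < i then 0 else coeff (binomial_prod D) (j - i))"
  by (simp add: binomial_prod_add_mset distrib_right coeff_monom_mult)

text \<open>A factor with exponent 0 is the constant 2; every other factor has constant term
  1.\<close>

lemma coeff_0_binomial_prod: "coeff (binomial_prod D) 0 = 2 ^ count D 0"
proof (induction D)
  case empty
  show ?case by (simp add: binomial_prod_def)
qed (simp add: coeff_binomial_prod_add_mset)

text \<open>When all exponents are at least \<open>m\<close> > 0, a term of degree \<open>m\<close>
  can only arise by taking the power of x from a single factor, whose exponent is
  \<open>m\<close>.\<close>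

lemma coeff_min_binomial_prod:
  assumes "m > 0" "\<And>i. i \<in># D \<Longrightarrow> m \<le> i"
  shows "coeff (binomial_prod D) m = int (count D m)"
  using assms(2)
proof (induction D)
  case empty
  show ?case using assms(1) by (simp add: binomial_prod_def)
next
  case (add i D)
  have i: "m \<le> i" using add.prems by simp
  have "0 \<notin># D" using add.prems assms(1) by force
  hence "coeff (binomial_prod D) 0 = 1" by (simp add: coeff_0_binomial_prod not_in_iff)
  moreover have "coeff (binomial_prod D) m = int (count D m)" using add by simp
  ultimately show ?case using i
    by (cases "i = m") (simp_all add: coeff_binomial_prod_add_mset)
qed

text \<open>The value at 1 reveals the number of factors, which settles the base case of
  injectivity.\<close>

lemma poly_1_binomial_prod: "poly (binomial_prod D) 1 = 2 ^ size D"
  by (induction D) (simp_all add: binomial_prod_def poly_monom)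

lemma binomial_prod_inject:
  assumes "binomial_prod D = binomial_prod E"
  shows "D = E"
  using assms
proof (induction "size D" arbitrary: D E)
  case 0
  have "(2::int) ^ size D = 2 ^ size E" using 0(2) by (metis poly_1_binomial_prod)
  hence "size D = size E" by simp
  thus ?case using 0(1) by (metis size_eq_0_iff_empty)
next
  case (Suc s)
  \<comment> \<open>The minimum over both multisets bounds each of them from below, so the
    coefficient at \<open>m\<close> gives its multiplicity in each, even before it is known to occur
    in both.\<close>
  define m where "m = Min (set_mset (D + E))"
  have "set_mset (D + E) \<noteq> {}" using Suc.hyps by auto
  hence mem: "m \<in># D + E" unfolding m_def by (intro Min_in finite_set_mset)
  have le: "m \<le> i" if "i \<in># D + E" for i unfolding m_def using that by (intro Min_le finite_set_mset)
  have "count D m = count E m"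
  proof (cases "m = 0")
    \<comment> \<open>Exponent 0 is special: its multiplicity is read off from a power of 2 in the
      constant term.\<close>
    case True
    have "(2::int) ^ count D 0 = 2 ^ count E 0" using Suc.prems by (metis coeff_0_binomial_prod)
    thus ?thesis using True by simp
  next
    case False
    thus ?thesis using coeff_min_binomial_prod[of m D] coeff_min_binomial_prod[of m E] le Suc.prems by simp
  qed
  hence "m \<in># D" "m \<in># E" using mem by (metis count_greater_zero_iff union_iff)+
  then obtain D' E' where DE: "D = add_mset m D'" "E = add_mset m E'" by (metis insert_DiffM)
  \<comment> \<open>The common factor is nonzero, hence can be cancelled in the integral domain of
    integer polynomials.\<close>
  have "poly (1 + monom 1 m :: int poly) 1 = 2" by (simp add: poly_monom)
  hence "(1 + monom 1 m :: int poly) \<noteq> 0" by force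
  hence "binomial_prod D' = binomial_prod E'" using Suc.prems by (simp add: DE binomial_prod_add_mset)
  thus ?case using Suc.hyps DE by simp
qed

lemma monom_mult_binomial_prod_inject:
  assumes "monom 1 a * binomial_prod D = monom 1 b * binomial_prod E"
  shows "D = E"
proof -
  have "coeff (monom 1 a * binomial_prod D) i = coeff (monom 1 b * binomial_prod E) i" for i
    using assms by simp
  \<comment> \<open>Constant terms of \<open>binomial_prod\<close> are nonzero, so \<open>a\<close>
    and \<open>b\<close> are the lowest degrees of the two sides; the coefficients at
    \<open>a\<close> and \<open>b\<close> exclude either strict inequality.\<close>
  from this[of a] this[of b] have "a = b"
    by (auto simp: coeff_monom_mult coeff_0_binomial_prod split: if_splits)
  hence "binomial_prod D = binomial_prod E" using assms by simp
  thus ?thesis by (rule binomial_prod_inject)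
qed

section \<open>Colorings by a complete bipartite graph\<close>

definition side_count :: "('a, 'b) pre_digraph \<Rightarrow> nat \<Rightarrow> nat" where
  "side_count G j = card {U \<in> sides G. card U = j}"

lemma sum_sides_eq_sum_side_count:
  fixes f :: "nat \<Rightarrow> 'c :: comm_semiring_1"
  assumes "finite (verts G)"
  shows "(\<Sum>U\<in>sides G. f (card U)) = (\<Sum>j\<le>card (verts G). of_nat (side_count G j) * f j)"
proof -
  have "(\<Sum>U\<in>sides G. f (card U)) = (\<Sum>j\<le>card (verts G). \<Sum>U | U \<in> sides G \<and> card U = j. f (card U))"
    using assms by (intro sum.group[symmetric] finite_sides) (auto intro: card_mono dest: sides_subset)
  also have "\<dots> = (\<Sum>j\<le>card (verts G). of_nat (side_count G j) * f j)"
    by (simp add: side_count_def)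
  finally show ?thesis .
qed

text \<open>\<open>monom 1 1\<close> is the polynomial variable, so the sum is the generating
  polynomial of the side counts.\<close>

lemma coeff_sum_sides:
  assumes "finite (verts G)"
  shows "coeff (\<Sum>U\<in>sides G. monom (1::int) 1 ^ card U) j = int (side_count G j)"
  using finite_sides[OF assms]
  by (simp add: monom_power coeff_sum side_count_def sum.If_cases Int_def conj_commute)

text \<open>Only the whole vertex set has full size, and it is a side exactly when no arc exists;
  this entry thus detects edgeless graphs.\<close>

lemma side_count_card_verts:
  assumes "finite (verts G)"
  shows "side_count G (card (verts G)) = (if verts G \<in> sides G then 1 else 0)"
proof -
  have "U = verts G" if "U \<in> sides G" "card U = card (verts G)" for U
    using that assms by (intro card_subset_eq sides_subset)
  hence "{U \<in> sides G. card U = card (verts G)} = (if verts G \<in> sides G then {verts G} else {})"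
    by auto
  thus ?thesis by (simp add: side_count_def)
qed

lemma side_count_eq_0:
  assumes "finite (verts G)" "j > card (verts G)"
  shows "side_count G j = 0"
proof -
  have "card U \<le> card (verts G)" if "U \<in> sides G" for U
    using that assms by (intro card_mono sides_subset)
  hence "{U \<in> sides G. card U = j} = {}" using assms(2) by force
  thus ?thesis unfolding side_count_def by (simp only: card.empty)
qed

lemma (in wf_digraph) Diff_sides_iff:
  assumes "U \<subseteq> verts G"
  shows "verts G - U \<in> sides G \<longleftrightarrow> U \<in> sides G"
  using assms by (auto simp: sides_iff)

text \<open>This is K_{m,n} with its parts named in a fixed order, so that a coloring singles out
  one side of \<open>G\<close>: the vertices whose colors label \<open>A\<close>. Adjacency is a set
  of ordered pairs, hence both products.\<close>

locale bipartite_target =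
  fixes H :: "('c, 'd) pre_digraph" and A B :: "'c set"
  assumes finite_verts_H: "finite (verts H)"
    and verts_H: "verts H = A \<union> B" and disjoint: "A \<inter> B = {}"
    and arcs_ends_H: "arcs_ends H = A \<times> B \<union> B \<times> A"
begin

abbreviation "N \<equiv> card (verts H)"

lemma adjacent_iff: "x \<in> verts H \<Longrightarrow> y \<in> verts H \<Longrightarrow> x \<rightarrow>\<^bsub>H\<^esub> y \<longleftrightarrow> (x \<in> A) \<noteq> (y \<in> A)"
  using verts_H disjoint by (auto simp: arcs_ends_H)

lemma proper_colorings_iff:
  assumes "wf_digraph G" "\<phi> \<in> labelings H"
  shows "\<kappa> \<in> proper_colorings G H \<phi> \<longleftrightarrow>
    \<kappa> \<in> verts G \<rightarrow>\<^sub>E {1..N} \<and> {v \<in> verts G. \<kappa> v \<in> \<phi> ` A} \<in> sides G"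
proof (cases "\<kappa> \<in> verts G \<rightarrow>\<^sub>E {1..N}")
  case True
  interpret G: wf_digraph G by fact
  have bij: "bij_betw \<phi> (verts H) {1..N}" using assms by (simp add: labelings_def)
  have inv: "inv_into (verts H) \<phi> c \<in> verts H" "inv_into (verts H) \<phi> c \<in> A \<longleftrightarrow> c \<in> \<phi> ` A"
    if "c \<in> {1..N}" for c
  proof -
    have "c \<in> \<phi> ` verts H" using bij that by (simp add: bij_betw_def)
    then obtain x where x: "x \<in> verts H" "c = \<phi> x" by blast
    have "inj_on \<phi> (verts H)" using bij by (simp add: bij_betw_def)
    thus "inv_into (verts H) \<phi> c \<in> verts H" "inv_into (verts H) \<phi> c \<in> A \<longleftrightarrow> c \<in> \<phi> ` A"
      using x verts_H by (auto simp: inj_on_image_mem_iff)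
  qed
  have adj: "inv_into (verts H) \<phi> (\<kappa> u) \<rightarrow>\<^bsub>H\<^esub> inv_into (verts H) \<phi> (\<kappa> v) \<longleftrightarrow> (\<kappa> u \<in> \<phi> ` A) \<noteq> (\<kappa> v \<in> \<phi> ` A)"
    if "u \<in> verts G" "v \<in> verts G" for u v
  proof -
    have "\<kappa> u \<in> {1..N}" "\<kappa> v \<in> {1..N}" using True that by auto
    thus ?thesis by (simp only: inv adjacent_iff)
  qed
  have "(\<forall>u v. u \<rightarrow>\<^bsub>G\<^esub> v \<longrightarrow> inv_into (verts H) \<phi> (\<kappa> u) \<rightarrow>\<^bsub>H\<^esub> inv_into (verts H) \<phi> (\<kappa> v)) \<longleftrightarrow>
      (\<forall>e\<in>arcs G. (\<kappa> (tail G e) \<in> \<phi> ` A) \<noteq> (\<kappa> (head G e) \<in> \<phi> ` A))"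
    using adj[OF G.tail_in_verts G.head_in_verts] unfolding arcs_ends_conv[of G] by blast
  thus ?thesis using True by (simp add: proper_colorings_def G.sides_iff)
qed (simp add: proper_colorings_def)

text \<open>Colorings are grouped by the side that they determine. For a fixed side the colors of
  the vertices are independent, so the sum factors into powers of two linear forms, and
  \<open>G\<close> enters only through its order and its side counts.\<close>

lemma sum_proper_colorings:
  fixes x :: "nat \<Rightarrow> 'z :: comm_semiring_1"
  assumes "fin_digraph G" "\<phi> \<in> labelings H"
  shows "(\<Sum>\<kappa>\<in>proper_colorings G H \<phi>. \<Prod>v\<in>verts G. x (\<kappa> v)) =
    (\<Sum>j\<le>card (verts G). of_nat (side_count G j) *
       ((\<Sum>i\<in>\<phi> ` A. x i) ^ j * (\<Sum>i\<in>{1..N} - \<phi> ` A. x i) ^ (card (verts G) - j)))"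
proof -
  interpret G: fin_digraph G by fact
  let ?S = "\<phi> ` A" and ?T = "{1..N} - \<phi> ` A" and ?V = "verts G"
  have S: "?S \<subseteq> {1..N}" using assms(2) verts_H by (auto simp: labelings_def)
  have fin: "finite ?S" "finite ?T" using S finite_subset by auto
  note iff = proper_colorings_iff[OF G.wf_digraph assms(2)]
  have "(\<Sum>\<kappa>\<in>proper_colorings G H \<phi>. \<Prod>v\<in>?V. x (\<kappa> v)) =
      (\<Sum>U\<in>sides G. \<Sum>\<kappa> | \<kappa> \<in> proper_colorings G H \<phi> \<and> {v\<in>?V. \<kappa> v \<in> ?S} = U. \<Prod>v\<in>?V. x (\<kappa> v))"
    by (intro sum.group[symmetric] finite_sides finite_colorings(2) G.finite_verts finite_verts_H)
       (auto simp: iff)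
  also have "\<dots> = (\<Sum>U\<in>sides G. (\<Sum>i\<in>?S. x i) ^ card U * (\<Sum>i\<in>?T. x i) ^ (card ?V - card U))"
  proof (intro sum.cong refl)
    fix U assume U: "U \<in> sides G"
    have sub: "U \<subseteq> ?V" using U by (rule sides_subset)
    have "{\<kappa>. \<kappa> \<in> proper_colorings G H \<phi> \<and> {v\<in>?V. \<kappa> v \<in> ?S} = U} =
        PiE ?V (\<lambda>v. if v \<in> U then ?S else ?T)" (is "?L = ?R")
    proof (intro equalityI subsetI)
      fix \<kappa> assume "\<kappa> \<in> ?L"
      thus "\<kappa> \<in> ?R" by (auto simp: iff PiE_iff)
    next
      fix \<kappa> assume \<kappa>: "\<kappa> \<in> ?R"
      hence *: "\<kappa> v \<in> ?S" if "v \<in> U" for v using PiE_mem[OF \<kappa>, of v] that sub by auto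
      moreover have **: "\<kappa> v \<in> ?T" if "v \<in> ?V" "v \<notin> U" for v using PiE_mem[OF \<kappa>, of v] that by auto
      ultimately have "{v\<in>?V. \<kappa> v \<in> ?S} = U" using sub by blast
      moreover have "\<kappa> v \<in> {1..N}" if "v \<in> ?V" for v using * ** S that by blast
      hence "\<kappa> \<in> ?V \<rightarrow>\<^sub>E {1..N}" using \<kappa> by (auto simp: PiE_iff)
      ultimately show "\<kappa> \<in> ?L" using U by (simp add: iff)
    qed
    hence "(\<Sum>\<kappa> | \<kappa> \<in> proper_colorings G H \<phi> \<and> {v\<in>?V. \<kappa> v \<in> ?S} = U. \<Prod>v\<in>?V. x (\<kappa> v)) =
        (\<Prod>v\<in>?V. \<Sum>i\<in>(if v \<in> U then ?S else ?T). x i)"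
      using fin by (simp only:) (intro prod_sum_PiE[symmetric] G.finite_verts, simp)
    also have "\<dots> = (\<Prod>v\<in>?V. if v \<in> U then \<Sum>i\<in>?S. x i else \<Sum>i\<in>?T. x i)"
      by (intro prod.cong) auto
    also have "\<dots> = (\<Sum>i\<in>?S. x i) ^ card (?V \<inter> U) * (\<Sum>i\<in>?T. x i) ^ card (?V - U)"
      by (simp add: prod.If_cases Diff_eq)
    also have "?V \<inter> U = U" using sub by auto
    also have "card (?V - U) = card ?V - card U"
      using sub by (intro card_Diff_subset) (auto intro: finite_subset)
    finally show "(\<Sum>\<kappa> | \<kappa> \<in> proper_colorings G H \<phi> \<and> {v\<in>?V. \<kappa> v \<in> ?S} = U. \<Prod>v\<in>?V. x (\<kappa> v)) =
        (\<Sum>i\<in>?S. x i) ^ card U * (\<Sum>i\<in>?T. x i) ^ (card ?V - card U)" .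
  qed
  also have "\<dots> = (\<Sum>j\<le>card ?V. of_nat (side_count G j) * ((\<Sum>i\<in>?S. x i) ^ j * (\<Sum>i\<in>?T. x i) ^ (card ?V - j)))"
    by (rule sum_sides_eq_sum_side_count) simp
  finally show ?thesis .
qed

lemma chromatic_sym_poly_cong:
  assumes "fin_digraph G" "fin_digraph G'" "card (verts G) = card (verts G')"
    and "side_count G = side_count G'"
  shows "chromatic_sym_poly G H = chromatic_sym_poly G' H"
  unfolding chromatic_sym_poly_def
  using assms by (intro sum.cong refl) (simp add: sum_proper_colorings)

section \<open>Reading off the side counts from monomials in two variables\<close>

text \<open>A coloring by the colors 1 and 2 only is determined by the color class of 1. If 1 and 2 label
  vertices of different parts of \<open>H\<close>, it is proper iff this class is a side of \<open>G\<close>; otherwise it is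
  proper iff \<open>G\<close> has no edges, that is, iff \<open>verts G\<close> is a side.\<close>

definition separating_labelings :: "('c \<Rightarrow> nat) set" where
  "separating_labelings = {\<phi> \<in> labelings H. (1 \<in> \<phi> ` A) \<noteq> (2 \<in> \<phi> ` A)}"

lemma card_two_colorings:
  assumes "fin_digraph G" "\<phi> \<in> labelings H" "N \<ge> 2" "j \<le> card (verts G)"
  defines "a \<equiv> Poly_Mapping.single 1 j + Poly_Mapping.single 2 (card (verts G) - j)"
  shows "card {\<kappa> \<in> proper_colorings G H \<phi>. \<forall>i. card {v \<in> verts G. \<kappa> v = i} = Poly_Mapping.lookup a i} =
    (if \<phi> \<in> separating_labelings then side_count G j
     else if verts G \<in> sides G then card (verts G) choose j else 0)"
proof -
  interpret G: fin_digraph G by fact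
  let ?V = "verts G" and ?S = "\<phi> ` A"
  define col where "col U = (\<lambda>v\<in>?V. if v \<in> U then 1 else (2::nat))" for U
  note iff = proper_colorings_iff[OF G.wf_digraph assms(2)]
  have lk: "Poly_Mapping.lookup a i = (if i = 1 then j else if i = 2 then card ?V - j else 0)" for i
    by (auto simp: a_def lookup_add lookup_single when_def)
  have pre: "{v\<in>?V. col U v \<in> ?S} = (if 1 \<in> ?S then (if 2 \<in> ?S then ?V else U) else if 2 \<in> ?S then ?V - U else {})"
    if "U \<subseteq> ?V" for U
    using that by (auto simp: col_def split: if_splits)
  \<comment> \<open>A separating labeling turns \<open>col U\<close> into \<open>U\<close> or its
    complement, which are sides together. Any other labeling gives the whole vertex set or the empty
    set, which are again sides together.\<close>
  have proper: "col U \<in> proper_colorings G H \<phi> \<longleftrightarrow>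
      (if \<phi> \<in> separating_labelings then U \<in> sides G else ?V \<in> sides G)" if "U \<subseteq> ?V" for U
  proof -
    have "col U \<in> ?V \<rightarrow>\<^sub>E {1..N}" using assms(3) by (auto simp: col_def)
    thus ?thesis using pre[OF that] G.Diff_sides_iff[OF that] G.Diff_sides_iff[of ?V] assms(2)
      by (auto simp: iff separating_labelings_def)
  qed
  have cls: "{v\<in>?V. col U v = 1} = U" "{v\<in>?V. col U v = 2} = ?V - U"
    if "U \<subseteq> ?V" for U
    using that by (auto simp: col_def split: if_splits)
  have content: "(\<forall>i. card {v \<in> ?V. col U v = i} = Poly_Mapping.lookup a i) \<longleftrightarrow> card U = j" if "U \<subseteq> ?V" for U
  proof
    assume "\<forall>i. card {v \<in> ?V. col U v = i} = Poly_Mapping.lookup a i"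
    from this[rule_format, of 1] show "card U = j" using cls[OF that] by (simp add: lk)
  next
    assume j: "card U = j"
    have 0: "{v \<in> ?V. col U v = i} = {}" if "i \<noteq> 1" "i \<noteq> 2" for i using that by (auto simp: col_def)
    have "card (?V - U) = card ?V - j" using that j by (subst card_Diff_subset) (auto intro: finite_subset)
    thus "\<forall>i. card {v \<in> ?V. col U v = i} = Poly_Mapping.lookup a i"
      using cls[OF that] j 0 by (simp add: lk)
  qed
  have surj: "\<kappa> = col {v\<in>?V. \<kappa> v = 1}"
    if "\<kappa> \<in> ?V \<rightarrow>\<^sub>E {1..N}" "\<forall>i. card {v \<in> ?V. \<kappa> v = i} = Poly_Mapping.lookup a i" for \<kappa>
  proof
    fix v
    \<comment> \<open>Any other color has exponent 0 in \<open>a\<close>, but its class would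
      contain \<open>v\<close>.\<close>
    have "\<kappa> v = 1 \<or> \<kappa> v = 2" if "v \<in> ?V"
    proof (rule ccontr)
      assume "\<not> ?thesis"
      hence "card {w \<in> ?V. \<kappa> w = \<kappa> v} = 0"
        using \<open>\<forall>i. card {v \<in> ?V. \<kappa> v = i} = Poly_Mapping.lookup a i\<close> by (simp add: lk)
      thus False using that by auto
    qed
    thus "\<kappa> v = col {v\<in>?V. \<kappa> v = 1} v"
      using that(1) by (cases "v \<in> ?V") (auto simp: col_def PiE_def extensional_def)
  qed
  let ?X = "{U. U \<subseteq> ?V \<and> card U = j \<and> (if \<phi> \<in> separating_labelings then U \<in> sides G else ?V \<in> sides G)}"
  let ?Y = "{\<kappa> \<in> proper_colorings G H \<phi>. \<forall>i. card {v \<in> ?V. \<kappa> v = i} = Poly_Mapping.lookup a i}"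
  have "bij_betw col ?X ?Y"
  proof (rule bij_betwI[where g = "\<lambda>\<kappa>. {v\<in>?V. \<kappa> v = 1}"])
    show "col \<in> ?X \<rightarrow> ?Y" using proper content by auto
    show "(\<lambda>\<kappa>. {v\<in>?V. \<kappa> v = 1}) \<in> ?Y \<rightarrow> ?X"
    proof
      fix \<kappa> assume \<kappa>: "\<kappa> \<in> ?Y"
      let ?U = "{v\<in>?V. \<kappa> v = 1}"
      have "\<kappa> = col ?U" using \<kappa> by (intro surj) (auto simp: iff)
      hence "col ?U \<in> ?Y" using \<kappa> by metis
      thus "?U \<in> ?X" using proper[of ?U] content[of ?U] by auto
    qed
    show "{v\<in>?V. col U v = 1} = U" if "U \<in> ?X" for U using cls that by blast
    show "col {v\<in>?V. \<kappa> v = 1} = \<kappa>" if "\<kappa> \<in> ?Y" for \<kappa> using surj[of \<kappa>] that by (auto simp: iff)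
  qed
  hence "card ?Y = card ?X" by (simp add: bij_betw_same_card)
  also have "\<dots> = (if \<phi> \<in> separating_labelings then side_count G j
     else if ?V \<in> sides G then card ?V choose j else 0)"
  proof (cases "\<phi> \<in> separating_labelings")
    case True
    hence "?X = {U \<in> sides G. card U = j}" by (auto dest: sides_subset)
    thus ?thesis using True by (simp add: side_count_def)
  qed (simp add: n_subsets)
  finally show ?thesis .
qed

text \<open>The labelings split into separating ones, each contributing the side count, and the
  rest, whose contribution sees only the order of \<open>G\<close> and whether it is
  edgeless.\<close>

lemma lookup_two_colors:
  assumes "fin_digraph G" "N \<ge> 2" "j \<le> card (verts G)"
  shows "Poly_Mapping.lookup (chromatic_sym_poly G H)
      (Poly_Mapping.single 1 j + Poly_Mapping.single 2 (card (verts G) - j)) =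
    int (card separating_labelings * side_count G j + card (labelings H - separating_labelings) *
      (if verts G \<in> sides G then card (verts G) choose j else 0))"
proof -
  interpret G: fin_digraph G by fact
  define a :: "nat \<Rightarrow>\<^sub>0 nat" where "a = Poly_Mapping.single 1 j + Poly_Mapping.single 2 (card (verts G) - j)"
  define X where "X = (if verts G \<in> sides G then card (verts G) choose j else 0)"
  note fin = finite_colorings[OF G.finite_verts finite_verts_H]
  have sep: "separating_labelings \<subseteq> labelings H" by (auto simp: separating_labelings_def)
  have "colorings_of G H a = Sigma (labelings H) (\<lambda>\<phi>. {\<kappa> \<in> proper_colorings G H \<phi>.
      \<forall>i. card {v \<in> verts G. \<kappa> v = i} = Poly_Mapping.lookup a i})"
    by (auto simp: colorings_of_def)
  hence "card (colorings_of G H a) = (\<Sum>\<phi>\<in>labelings H. if \<phi> \<in> separating_labelings then side_count G j else X)"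
    using fin card_two_colorings[OF assms(1) _ assms(2,3), folded a_def X_def]
    by (simp add: card_SigmaI)
  also have "\<dots> = card separating_labelings * side_count G j + card (labelings H - separating_labelings) * X"
    using fin(1) sep by (simp add: sum.If_cases Int_absorb1 Int_absorb2 Diff_eq)
  finally show ?thesis
    unfolding a_def X_def by (simp add: lookup_chromatic finite_verts_H)
qed

text \<open>This makes the factor of the side count in the coefficients positive, so that it can be
  cancelled.\<close>

lemma separating_labelings_nonempty:
  assumes "A \<noteq> {}" "B \<noteq> {}"
  shows "separating_labelings \<noteq> {}"
proof -
  have fin: "finite A" "finite B" using finite_verts_H verts_H by auto
  have N: "N = card A + card B" using fin disjoint by (simp add: verts_H card_Un_disjoint)
  have pos: "card A > 0" "card B > 0" using assms fin by (auto simp: card_gt_0_iff)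
  \<comment> \<open>As many labels as \<open>A\<close> has vertices, with 1 and without 2. They stay
    within \<open>N\<close> because \<open>B\<close> is nonempty.\<close>
  define S where "S = insert 1 {3..card A + 1}"
  have S: "finite S" "S \<subseteq> {1..N}" "card S = card A" "1 \<in> S" "2 \<notin> S"
    using pos N by (auto simp: S_def)
  have T: "card ({1..N} - S) = card B" using S N by (simp add: card_Diff_subset)
  obtain f where f: "bij_betw f A S" using fin S by (metis finite_same_card_bij)
  obtain g where g: "bij_betw g B ({1..N} - S)" using fin T by (metis finite_Diff finite_atLeastAtMost finite_same_card_bij)
  define \<phi> where "\<phi> = (\<lambda>x\<in>verts H. if x \<in> A then f x else g x)"
  have "bij_betw \<phi> A S" using f by (rule bij_betw_cong[THEN iffD1, rotated]) (auto simp: \<phi>_def verts_H)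
  moreover have "bij_betw \<phi> B ({1..N} - S)"
    using g disjoint by (intro bij_betw_cong[THEN iffD1, OF _ g]) (auto simp: \<phi>_def verts_H)
  ultimately have "bij_betw \<phi> (A \<union> B) (S \<union> ({1..N} - S))" by (intro bij_betw_combine) auto
  moreover have "S \<union> ({1..N} - S) = {1..N}" using S by blast
  ultimately have bij: "bij_betw \<phi> (verts H) {1..N}" by (simp add: verts_H)
  moreover have "\<phi> \<in> extensional (verts H)" by (simp add: \<phi>_def)
  ultimately have "\<phi> \<in> labelings H"
    using bij_betw_apply[OF bij] by (simp add: labelings_def PiE_iff)
  moreover have "\<phi> ` A = S" using \<open>bij_betw \<phi> A S\<close> by (simp add: bij_betw_def)
  ultimately have "\<phi> \<in> separating_labelings" using S by (simp add: separating_labelings_def)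
  thus ?thesis by blast
qed

lemma side_count_eqI:
  assumes "A \<noteq> {}" "B \<noteq> {}" "fin_digraph G" "fin_digraph G'" "card (verts G) = card (verts G')"
    and "chromatic_sym_poly G H = chromatic_sym_poly G' H"
  shows "side_count G = side_count G'"
proof
  interpret G: fin_digraph G by fact
  interpret G': fin_digraph G' by fact
  let ?k = "card (verts G)"
  let ?p = "card separating_labelings" and ?q = "card (labelings H - separating_labelings)"
  have "finite A" "finite B" using finite_verts_H verts_H by auto
  hence "card A > 0" "card B > 0" using assms by (auto simp: card_gt_0_iff)
  hence N: "N \<ge> 2" using disjoint \<open>finite A\<close> \<open>finite B\<close> by (simp add: verts_H card_Un_disjoint)
  have "finite separating_labelings"
    using finite_colorings(1)[OF G.finite_verts finite_verts_H] by (simp add: separating_labelings_def)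
  hence p: "?p > 0" using separating_labelings_nonempty[OF assms(1,2)] by (simp add: card_gt_0_iff)
  have eq: "?p * side_count G j + ?q * (if verts G \<in> sides G then ?k choose j else 0) =
      ?p * side_count G' j + ?q * (if verts G' \<in> sides G' then ?k choose j else 0)" if "j \<le> ?k" for j
    using lookup_two_colors[OF assms(3) N, of j] lookup_two_colors[OF assms(4) N, of j] that assms(5,6)
    by (simp del: of_nat_add of_nat_mult add: of_nat_eq_iff)
  \<comment> \<open>At \<open>j = ?k\<close> the side count and the other term are both the
    indicator of edgelessness, so the equation reads (p + q) times this indicator on each side, with
    p > 0. The second summands then agree for all \<open>j\<close>.\<close>
  have "verts G \<in> sides G \<longleftrightarrow> verts G' \<in> sides G'"
    using eq[of ?k] side_count_card_verts[of G] side_count_card_verts[of G'] assms(5) p by (auto split: if_splits)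
  hence small: "side_count G j = side_count G' j" if "j \<le> ?k" for j using eq[OF that] p by simp
  fix j show "side_count G j = side_count G' j"
    using small[of j] side_count_eq_0[of G j] side_count_eq_0[of G' j] assms(5) by (cases "j \<le> ?k") auto
qed

end

section \<open>From symmetric polynomials to symmetric functions\<close>

text \<open>The polynomial is the truncation of the symmetric function to the first n variables:
  both carry the same coefficients from the unique monomial expansion.\<close>

lemma lookup_chromatic_sym_poly:
  assumes "graph F" "graph H"
  shows "Poly_Mapping.lookup (chromatic_sym_poly F H) a =
    (if Poly_Mapping.keys a \<subseteq> {1..card (verts H)} then chromatic_sym_fun F H a else 0)"
proof -
  let ?P = "partitions (card (verts F)) (card (verts H))"
  have "is_monomial_expansion (card (verts F)) (card (verts H)) (chromatic_sym_poly F H) (monomial_coeffs F H)"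
    unfolding monomial_coeffs_def by (rule theI'[OF ex1_monomial_expansion[OF assms]])
  hence exp: "chromatic_sym_poly F H =
      (\<Sum>l\<in>?P. of_int (monomial_coeffs F H l) * monomial_sym_poly (card (verts H)) l)"
    by (simp add: is_monomial_expansion_def)
  have "Poly_Mapping.lookup (chromatic_sym_poly F H) a = (if Poly_Mapping.keys a \<subseteq> {1..card (verts H)} \<and>
      exponents a \<in> ?P then monomial_coeffs F H (exponents a) else 0)"
    by (subst exp) (rule lookup_expansion)
  moreover have "chromatic_sym_fun F H a = (\<Sum>l\<in>?P. if exponents a = l then
      (if 0 \<notin> Poly_Mapping.keys a then monomial_coeffs F H l else 0) else 0)"
    unfolding chromatic_sym_fun_def monomial_sym_fun_def by (intro sum.cong) auto
  ultimately show ?thesis by (auto simp: sum.delta' finite_partitions)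
qed

text \<open>The symmetric function is built from the coefficients of the polynomial, and truncation
  recovers the polynomial.\<close>

lemma chromatic_sym_poly_eq_iff_fun:
  assumes "graph G" "graph G'" "graph H" "card (verts G) = card (verts G')"
  shows "chromatic_sym_poly G H = chromatic_sym_poly G' H \<longleftrightarrow> chromatic_sym_fun G H = chromatic_sym_fun G' H"
proof
  assume "chromatic_sym_poly G H = chromatic_sym_poly G' H"
  thus "chromatic_sym_fun G H = chromatic_sym_fun G' H"
    using assms(4) by (simp add: chromatic_sym_fun_def monomial_coeffs_def)
next
  assume "chromatic_sym_fun G H = chromatic_sym_fun G' H"
  thus "chromatic_sym_poly G H = chromatic_sym_poly G' H"
    by (intro poly_mapping_eqI) (simp add: lookup_chromatic_sym_poly assms(1-3))
qed

section \<open>Side counts and diff\<close>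

lemma sum_monom_sides_diff:
  assumes "graph G" "is_diff G d"
  shows "(\<Sum>U\<in>sides G. monom (1::int) 1 ^ card U) =
    monom 1 ((card (verts G) - sum_list (map nat d)) div 2) * binomial_prod (mset (map nat d))"
proof -
  interpret G: graph G by fact
  show ?thesis unfolding G.sum_sides_eq_prod_diff[OF assms(2)]
    by (simp add: binomial_prod_def monom_power)
qed

text \<open>The entries are absolute values, so nothing is lost when they become natural numbers to
  serve as exponents.\<close>

lemma is_diff_nonneg:
  assumes "is_diff G d"
  shows "map int (map nat d) = d"
proof -
  have "x \<ge> 0" if "x \<in> set d" for x
    using assms that by (auto simp: is_diff_def list_all2_conv_all_nth in_set_conv_nth)
  thus ?thesis by (auto intro: map_idI)
qed

text \<open>Both data are encoded by the same generating polynomial: the side counts are its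
  coefficients, and diff is recovered from its factors.\<close>

lemma side_count_eq_iff_diff:
  assumes "graph G" "graph G'" "card (verts G) = card (verts G')" "is_diff G d" "is_diff G' d'"
  shows "side_count G = side_count G' \<longleftrightarrow> mset d = mset d'"
proof
  interpret G: graph G by fact
  interpret G': graph G' by fact
  assume "side_count G = side_count G'"
  hence "(\<Sum>U\<in>sides G. monom (1::int) 1 ^ card U) = (\<Sum>U\<in>sides G'. monom 1 1 ^ card U)"
    by (intro poly_eqI) (simp add: coeff_sum_sides del: One_nat_def)
  hence "mset (map nat d) = mset (map nat d')"
    unfolding sum_monom_sides_diff[OF assms(1,4)] sum_monom_sides_diff[OF assms(2,5)]
    by (rule monom_mult_binomial_prod_inject)
  from arg_cong[OF this, of "image_mset int"]
  have "mset (map int (map nat d)) = mset (map int (map nat d'))" by (simp only: mset_map)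
  thus "mset d = mset d'" by (simp only: is_diff_nonneg[OF assms(4)] is_diff_nonneg[OF assms(5)])
next
  interpret G: graph G by fact
  interpret G': graph G' by fact
  assume "mset d = mset d'"
  hence "mset (map nat d) = mset (map nat d')" by simp
  \<comment> \<open>Equal sums and equal orders give the same leading power of the variable.\<close>
  moreover from this have "sum_list (map nat d) = sum_list (map nat d')" by (metis sum_mset_sum_list)
  ultimately have "(\<Sum>U\<in>sides G. monom (1::int) 1 ^ card U) = (\<Sum>U\<in>sides G'. monom 1 1 ^ card U)"
    unfolding sum_monom_sides_diff[OF assms(1,4)] sum_monom_sides_diff[OF assms(2,5)] using assms(3) by simp
  hence "int (side_count G j) = int (side_count G' j)" for j
    by (metis coeff_sum_sides G.finite_verts G'.finite_verts)
  thus "side_count G = side_count G'" by auto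
qed

theorem proposition5p10:
  fixes G\<^sub>1 :: "('a, 'b) pre_digraph" and G\<^sub>2 :: "('c, 'd) pre_digraph" and K :: "('e, 'f) pre_digraph"
    and k m n :: nat and d\<^sub>1 d\<^sub>2 :: "int list"
  assumes "graph G\<^sub>1" and "graph G\<^sub>2"
    and "verts G\<^sub>1 \<noteq> {}" and "verts G\<^sub>2 \<noteq> {}"
    and "bipartite G\<^sub>1" and "bipartite G\<^sub>2"
    and "card (verts G\<^sub>1) = k" and "card (verts G\<^sub>2) = k"
    and "card (components G\<^sub>1) = card (components G\<^sub>2)"
    and "m \<ge> 1" and "n \<ge> 1"
    and "K\<^bsub>m,n\<^esub> K"
    and "is_diff G\<^sub>1 d\<^sub>1" and "is_diff G\<^sub>2 d\<^sub>2"
  shows "chromatic_sym_fun G\<^sub>1 K = chromatic_sym_fun G\<^sub>2 K \<longleftrightarrow> d\<^sub>1 <~~> d\<^sub>2"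
proof -
  interpret G1: graph G\<^sub>1 by fact
  interpret G2: graph G\<^sub>2 by fact
  obtain A B where K: "graph K" and AB: "verts K = A \<union> B" "A \<inter> B = {}" "card A = m" "card B = n"
      "arcs_ends K = A \<times> B \<union> B \<times> A"
    using assms(12) by (auto simp: complete_bipartite_digraph_def)
  interpret K: graph K by fact
  interpret bipartite_target K A B using AB K.finite_verts by unfold_locales auto
  \<comment> \<open>With both parts nonempty, two colors can be placed in different parts, which is
    what recovers the side counts.\<close>
  have ne: "A \<noteq> {}" "B \<noteq> {}" using AB assms(10,11) by auto
  have k: "card (verts G\<^sub>1) = card (verts G\<^sub>2)" using assms by simp
  have "chromatic_sym_fun G\<^sub>1 K = chromatic_sym_fun G\<^sub>2 K \<longleftrightarrow> chromatic_sym_poly G\<^sub>1 K = chromatic_sym_poly G\<^sub>2 K"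
    using chromatic_sym_poly_eq_iff_fun[OF assms(1,2) K k] by simp
  also have "\<dots> \<longleftrightarrow> side_count G\<^sub>1 = side_count G\<^sub>2"
    using side_count_eqI[OF ne G1.fin_digraph_axioms G2.fin_digraph_axioms k]
      chromatic_sym_poly_cong[OF G1.fin_digraph_axioms G2.fin_digraph_axioms k] by blast
  also have "\<dots> \<longleftrightarrow> d\<^sub>1 <~~> d\<^sub>2" by (rule side_count_eq_iff_diff[OF assms(1,2) k assms(13,14)])
  finally show ?thesis .
qed

end
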